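(* Let $G$ be a connected graph with $\operatorname{diam}(G)=2$. Then for every two distinct vertices $u,v\in V(G)$, $$r_G(u,v)\le (3+\sqrt5)\left(\frac1{d_G(u)}+\frac1{d_G(v)}\right).$$
   Context: All graphs are finite, simple, undirected and unweighted. $d_G(u)$ denotes the degree of the vertex $u$ in $G$. The diameter $\operatorname{diam}(G)$ of a connected graph is the maximum shortest-path distance between two of its vertices. For vertices $u,v$ of a connected graph $G$, the resistance distance $r_G(u,v)$ is the effective resistance between $u$ and $v$ in the electrical network obtained from $G$ by replacing each edge with a $1$-ohm resistor. Equivalently, $r_G(u,u)=0$ and, for $u\neq v$, $r_G(u,v)=\phi(u)-\phi(v)$, where $\phi:V(G)\to\mathbb R$ is any solution of $L_G\phi=e_u-e_v$; here $(L_G\phi)(x)=\sum_{y\sim x}(\phi(x)-\phi(y))$ is the graph Laplacian and $e_u$ is the unit vector at $u$ (the solution is unique up to an additive constant). *)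

theory Defs
  imports "Graph_Theory.Graph_Theory"
begin

text \<open>
  Finite simple undirected graphs are those of the locale \<^locale>\<open>graph\<close>: symmetric loop-free
  digraphs without parallel arcs, in which an undirected edge is a pair of opposite arcs. The degree
  of a vertex is therefore its \<^const>\<open>out_degree\<close>.
\<close>

lemma (in graph) out_degree_eq_card_neighbours:
  "out_degree G u = card {x. u \<rightarrow>\<^bsub>G\<^esub> x}"
proof -
  have "bij_betw (head G) (out_arcs G u) {x. u \<rightarrow>\<^bsub>G\<^esub> x}"
    unfolding bij_betw_def
    by (auto simp: inj_on_def arcs_ends_conv arc_to_ends_def intro: no_multi_arcs)
  then show ?thesis
    unfolding out_degree_def by (rule bij_betw_same_card)
qed

definition graph_dist :: "('a, 'b) pre_digraph \<Rightarrow> 'a \<Rightarrow> 'a \<Rightarrow> ereal" where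
  "graph_dist G u v = wf_digraph.\<mu> G (\<lambda>_. 1) u v"

definition graph_diameter :: "('a, 'b) pre_digraph \<Rightarrow> ereal" where
  "graph_diameter G = Max {graph_dist G u v | u v. u \<in> verts G \<and> v \<in> verts G}"

definition laplacian :: "('a, 'b) pre_digraph \<Rightarrow> ('a \<Rightarrow> real) \<Rightarrow> 'a \<Rightarrow> real" where
  "laplacian G \<phi> x = (\<Sum>y | x \<rightarrow>\<^bsub>G\<^esub> y. \<phi> x - \<phi> y)"

text \<open>
  The values of \<open>\<phi>\<close> outside \<open>verts G\<close> are irrelevant. For connected \<open>G\<close> and \<open>u\<close>, \<open>v\<close> in \<open>verts G\<close>,
  a potential \<open>\<phi>\<close> exists and \<open>\<phi> u - \<phi> v\<close> does not depend on its choice, so the description below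
  denotes that value.
\<close>

definition is_potential :: "('a, 'b) pre_digraph \<Rightarrow> 'a \<Rightarrow> 'a \<Rightarrow> ('a \<Rightarrow> real) \<Rightarrow> bool" where
  "is_potential G u v \<phi> \<longleftrightarrow>
     (\<forall>x \<in> verts G. laplacian G \<phi> x = of_bool (x = u) - of_bool (x = v))"

definition resistance_distance :: "('a, 'b) pre_digraph \<Rightarrow> 'a \<Rightarrow> 'a \<Rightarrow> real" where
  "resistance_distance G u v =
     (if u = v then 0 else (THE r. \<exists>\<phi>. is_potential G u v \<phi> \<and> r = \<phi> u - \<phi> v))"

end

theory Submission
  imports Defs "Jordan_Normal_Form.Determinant"
begin

text \<open>
  Let \<open>\<phi>\<close> be a potential for the unit current from \<open>u\<close> to \<open>v\<close>, and let \<open>r = \<phi> u - \<phi> v\<close>. Its Dirichlet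
  energy, the sum of \<open>(\<phi> x - \<phi> y)\<^sup>2\<close> over the edges, also equals \<open>r\<close>. The proof plays this identity
  against paths that run from a neighbour of \<open>u\<close> to a neighbour of \<open>v\<close> in at most two steps.

  Since \<open>\<phi>\<close> has Laplacian \<open>1\<close> at \<open>u\<close>, its mean over the \<open>m\<close> neighbours of \<open>u\<close> is exactly
  \<open>\<phi> u - 1 / m\<close>; likewise it is \<open>\<phi> v + 1 / n\<close> over the \<open>n\<close> neighbours of \<open>v\<close>. So \<open>r\<close> is
  \<open>1 / m + 1 / n\<close> plus the mean of \<open>\<phi> a - \<phi> b\<close> over all pairs of neighbours \<open>a\<close> of \<open>u\<close> and \<open>b\<close> of \<open>v\<close>.
  As the distance of \<open>a\<close> and \<open>b\<close> is at most two, there is a path \<open>a, w, b\<close> (with repetitions allowed).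
  The vertex \<open>w\<close> depends on the pair, but the drop from \<open>a\<close> to \<open>w\<close> can be bounded through \<open>a\<close> alone: its
  square is at most the energy \<open>D a\<close> of the edges that descend from \<open>a\<close>, whence the drop is at most
  \<open>m / 4 * D a + 1 / m\<close> by the inequality of arithmetic and geometric means. In the same way the
  drop from \<open>w\<close> to \<open>b\<close> is bounded through the edges that ascend from \<open>b\<close>. Each edge descends from only one of
  its ends, so the \<open>D a\<close> add up to at most \<open>r\<close>, and the mean of \<open>m / 4 * D a + 1 / m\<close> over \<open>a\<close> is at most
  \<open>r / 4 + 1 / m\<close>. Altogether \<open>r \<le> 2 / m + 2 / n + r / 2\<close>, that is \<open>r \<le> 4 * (1 / m + 1 / n)\<close>, and
  \<open>4 \<le> 3 + sqrt 5\<close>.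

  The resistance distance is given by a definite description, so existence of a potential and uniqueness of
  \<open>\<phi> u - \<phi> v\<close> have to be established as well. Both rest on the fact that, in a connected graph, only
  constant functions are harmonic, which is again read off from the energy.
\<close>

section \<open>Averages and linear systems over a finite set\<close>

text \<open>
  This is what replaces averaging over pairs \<open>(a, b)\<close>: a bound on \<open>\<phi> a - \<phi> b\<close> by a function of \<open>a\<close> plus
  a function of \<open>b\<close> separates into a bound of the form \<open>f a \<le> g b\<close>.
\<close>

lemma mean_le_mean:
  fixes f :: "'a \<Rightarrow> real" and g :: "'b \<Rightarrow> real"
  assumes "finite A" "A \<noteq> {}" "finite B" "B \<noteq> {}"
    and le: "\<And>a b. a \<in> A \<Longrightarrow> b \<in> B \<Longrightarrow> f a \<le> g b"
  shows "sum f A / card A \<le> sum g B / card B"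
proof -
  define c where "c = Max (f ` A)"
  have "f a \<le> c" if "a \<in> A" for a
    using that assms by (simp add: c_def)
  then have "sum f A \<le> card A * c"
    using sum_bounded_above[of A f c] by simp
  moreover have "c \<in> f ` A"
    unfolding c_def using assms by (intro Max_in) auto
  then have "c \<le> g b" if "b \<in> B" for b
    using le that by auto
  then have "card B * c \<le> sum g B"
    using sum_bounded_below[of B c g] by simp
  moreover have "card A > 0" "card B > 0"
    using assms by (simp_all add: card_gt_0_iff)
  ultimately have "sum f A / card A \<le> c" "c \<le> sum g B / card B"
    by (simp_all add: field_simps)
  then show ?thesis by linarith
qed

text \<open>
  An endomorphism of a finite-dimensional space is onto if it is injective. After numbering \<open>V\<close> this is
  the statement that a matrix with trivial kernel has nonzero determinant, and the adjugate then gives the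
  solution.
\<close>

lemma square_system_solvable:
  fixes K :: "'a \<Rightarrow> 'a \<Rightarrow> 'k::field"
  assumes "finite V"
    and kernel: "\<And>f. (\<And>x. x \<in> V \<Longrightarrow> (\<Sum>y\<in>V. K x y * f y) = 0) \<Longrightarrow> \<forall>x\<in>V. f x = 0"
  shows "\<exists>f. \<forall>x\<in>V. (\<Sum>y\<in>V. K x y * f y) = b x"
proof -
  define n where "n = card V"
  obtain e where e: "bij_betw e {0..<n} V"
    using ex_bij_betw_nat_finite[OF \<open>finite V\<close>] n_def by blast
  define d where "d = the_inv_into {0..<n} e"
  have d: "bij_betw d V {0..<n}"
    unfolding d_def by (rule bij_betw_the_inv_into[OF e])
  have ed: "e (d x) = x" if "x \<in> V" for x
    unfolding d_def using e that by (simp add: f_the_inv_into_f_bij_betw)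
  have de: "d (e i) = i" if "i < n" for i
    unfolding d_def using e that by (simp add: the_inv_into_f_f bij_betw_def)
  have dn: "d x < n" if "x \<in> V" for x
    using d that by (auto simp: bij_betw_def)
  have eV: "e i \<in> V" if "i < n" for i
    using e that by (auto simp: bij_betw_def)
  define A where "A = mat n n (\<lambda>(i, j). K (e i) (e j))"
  have A: "A \<in> carrier_mat n n" by (simp add: A_def)
  have A_mult: "(A *\<^sub>v w) $ d x = (\<Sum>y\<in>V. K x y * w $ d y)"
    if "w \<in> carrier_vec n" "x \<in> V" for w x
  proof -
    have "(A *\<^sub>v w) $ d x = (\<Sum>j = 0..<n. K x (e j) * w $ j)"
      using that dn[of x] ed[of x] by (simp add: A_def scalar_prod_def)
    also have "\<dots> = (\<Sum>j = 0..<n. K x (e j) * w $ d (e j))"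
      by (intro sum.cong) (auto simp: de)
    also have "\<dots> = (\<Sum>y\<in>V. K x y * w $ d y)"
      by (rule sum.reindex_bij_betw[OF e])
    finally show ?thesis .
  qed
  have "det A \<noteq> 0"
  proof
    assume "det A = 0"
    then obtain w where w: "w \<in> carrier_vec n" "w \<noteq> 0\<^sub>v n" "A *\<^sub>v w = 0\<^sub>v n"
      using det_0_iff_vec_prod_zero_field[OF A] by blast
    have "\<forall>x\<in>V. w $ d x = 0"
    proof (rule kernel)
      fix x assume "x \<in> V"
      then show "(\<Sum>y\<in>V. K x y * w $ d y) = 0"
        using A_mult[OF w(1), of x] w(3) dn by simp
    qed
    then have "w $ i = 0" if "i < n" for i
      using eV[OF that] de[OF that] by fastforce
    then have "w = 0\<^sub>v n" using w(1) by auto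
    with w(2) show False by simp
  qed
  define c where "c = vec n (\<lambda>i. b (e i))"
  define w where "w = (1 / det A) \<cdot>\<^sub>v (adj_mat A *\<^sub>v c)"
  have c: "c \<in> carrier_vec n" by (simp add: c_def)
  have adj_c: "adj_mat A *\<^sub>v c \<in> carrier_vec n"
    using adj_mat(1)[OF A] c by (rule mult_mat_vec_carrier)
  have "A *\<^sub>v w = (1 / det A) \<cdot>\<^sub>v (A *\<^sub>v (adj_mat A *\<^sub>v c))"
    unfolding w_def by (rule mult_mat_vec[OF A adj_c])
  also have "A *\<^sub>v (adj_mat A *\<^sub>v c) = (A * adj_mat A) *\<^sub>v c"
    by (rule assoc_mult_mat_vec[OF A adj_mat(1)[OF A] c, symmetric])
  also have "\<dots> = det A \<cdot>\<^sub>v c"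
    using c by (intro eq_vecI) (auto simp: adj_mat(2)[OF A] row_smult)
  finally have Aw: "A *\<^sub>v w = c"
    using \<open>det A \<noteq> 0\<close> c by (simp add: smult_smult_assoc)
  have "w \<in> carrier_vec n" using adj_c by (simp add: w_def)
  then have "(\<Sum>y\<in>V. K x y * w $ d y) = b x" if "x \<in> V" for x
    using A_mult[of w x] Aw that dn ed by (simp add: c_def)
  then show ?thesis by (intro exI[of _ "\<lambda>x. w $ d x"] ballI)
qed

section \<open>Dirichlet energy\<close>

text \<open>
  The energy is kept per vertex and one-sided. Each edge is counted at its higher end only, so that the total is the
  Dirichlet energy itself and not its double; a two-sided count would spoil the constant. The energy of
  the edges ascending from \<open>x\<close> is the descent energy of \<open>- \<phi>\<close>.
\<close>

definition descent_energy :: "('a, 'b) pre_digraph \<Rightarrow> ('a \<Rightarrow> real) \<Rightarrow> 'a \<Rightarrow> real" where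
  "descent_energy G \<phi> x = (\<Sum>y | x \<rightarrow>\<^bsub>G\<^esub> y. (max 0 (\<phi> x - \<phi> y))\<^sup>2)"

lemma laplacian_uminus: "laplacian G (\<lambda>x. - \<phi> x) x = - laplacian G \<phi> x"
  by (simp add: laplacian_def sum_negf[symmetric])

lemma laplacian_diff:
  "laplacian G (\<lambda>x. \<phi> x - \<psi> x) x = laplacian G \<phi> x - laplacian G \<psi> x"
  by (simp add: laplacian_def sum_subtractf[symmetric] algebra_simps)

lemma descent_energy_nonneg: "descent_energy G \<phi> x \<ge> 0"
  by (simp add: descent_energy_def sum_nonneg)

context graph
begin

lemma finite_neighbours: "finite {y. x \<rightarrow>\<^bsub>G\<^esub> y}"
  by (rule finite_subset[OF _ finite_verts]) (auto dest: adj_in_verts)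

lemma adj_sym: "x \<rightarrow>\<^bsub>G\<^esub> y \<Longrightarrow> y \<rightarrow>\<^bsub>G\<^esub> x"
  using arcs_ends_symmetric[OF sym_arcs] .

lemma square_drop_le_descent_energy:
  assumes "x \<rightarrow>\<^bsub>G\<^esub> y"
  shows "(max 0 (\<phi> x - \<phi> y))\<^sup>2 \<le> descent_energy G \<phi> x"
  unfolding descent_energy_def using assms
  by (intro member_le_sum[of y _ "\<lambda>y. (max 0 (\<phi> x - \<phi> y))\<^sup>2"]) (auto simp: finite_neighbours)

lemma sum_over_arcs:
  "(\<Sum>x\<in>verts G. \<Sum>y | x \<rightarrow>\<^bsub>G\<^esub> y. h x y) = (\<Sum>(x, y)\<in>arcs_ends G. h x y)"
proof -
  have "(SIGMA x:verts G. {y. x \<rightarrow>\<^bsub>G\<^esub> y}) = arcs_ends G"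
    by (auto dest: adj_in_verts)
  then show ?thesis
    using sum.Sigma[of "verts G" "\<lambda>x. {y. x \<rightarrow>\<^bsub>G\<^esub> y}" h] finite_neighbours by simp
qed

lemma sum_over_arcs_swap:
  "(\<Sum>(x, y)\<in>arcs_ends G. h x y) = (\<Sum>(x, y)\<in>arcs_ends G. h y x)"
  by (rule sum.reindex_bij_witness[of _ prod.swap prod.swap]) (auto intro: adj_sym)

lemma sum_laplacian_eq_0: "(\<Sum>x\<in>verts G. laplacian G \<phi> x) = 0"
proof -
  have "(\<Sum>(x, y)\<in>arcs_ends G. \<phi> x - \<phi> y) = (\<Sum>(x, y)\<in>arcs_ends G. \<phi> y - \<phi> x)"
    by (rule sum_over_arcs_swap)
  also have "\<dots> = - (\<Sum>(x, y)\<in>arcs_ends G. \<phi> x - \<phi> y)"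
    by (simp add: sum_negf[symmetric] case_prod_unfold)
  finally show ?thesis by (simp add: laplacian_def sum_over_arcs)
qed

text \<open>
  Discrete integration by parts. Both sides equal half the sum of \<open>(\<phi> x - \<phi> y)\<^sup>2\<close> over all arcs, because
  reversing the arcs turns descents into ascents.
\<close>

lemma sum_descent_energy:
  "(\<Sum>x\<in>verts G. descent_energy G \<phi> x) = (\<Sum>x\<in>verts G. \<phi> x * laplacian G \<phi> x)"
proof -
  let ?S = "\<lambda>h. \<Sum>(x, y)\<in>arcs_ends G. h x y"
  let ?D = "?S (\<lambda>x y. (max 0 (\<phi> x - \<phi> y))\<^sup>2)"
  let ?Q = "?S (\<lambda>x y. \<phi> x * (\<phi> x - \<phi> y))"
  have sq: "(max 0 t)\<^sup>2 + (max 0 (- t))\<^sup>2 = t\<^sup>2" for t :: real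
    by (simp add: max_def)
  have "2 * ?D = ?D + ?S (\<lambda>x y. (max 0 (\<phi> y - \<phi> x))\<^sup>2)"
    using sum_over_arcs_swap[of "\<lambda>x y. (max 0 (\<phi> x - \<phi> y))\<^sup>2"] by simp
  also have "\<dots> = ?S (\<lambda>x y. (\<phi> x - \<phi> y)\<^sup>2)"
    using sq[of "\<phi> x - \<phi> y" for x y] by (simp add: sum.distrib[symmetric] case_prod_unfold)
  also have "\<dots> = ?Q + ?S (\<lambda>x y. \<phi> y * (\<phi> y - \<phi> x))"
    by (simp add: sum.distrib[symmetric] case_prod_unfold power2_eq_square algebra_simps)
  also have "\<dots> = 2 * ?Q"
    using sum_over_arcs_swap[of "\<lambda>x y. \<phi> x * (\<phi> x - \<phi> y)"] by simp
  finally have "?D = ?Q" by simp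
  then show ?thesis
    by (simp add: descent_energy_def laplacian_def sum_over_arcs sum_distrib_left)
qed

section \<open>Existence and uniqueness of the potential\<close>

lemma connected_imp_reachable:
  assumes "connected G" "x \<in> verts G" "y \<in> verts G"
  shows "x \<rightarrow>\<^sup>*\<^bsub>G\<^esub> y"
  using assms reachable_mk_symmetric_eq[OF sym_arcs]
  by (auto simp: connected_def strongly_connected_def)

text \<open>
  A harmonic function has zero energy, so it does not drop along any arc. By symmetry it is
  constant along arcs, hence on the connected graph.
\<close>

lemma harmonic_imp_constant:
  assumes "connected G" and harmonic: "\<And>x. x \<in> verts G \<Longrightarrow> laplacian G f x = 0"
    and "x \<in> verts G" "y \<in> verts G"
  shows "f x = f y"
proof -
  have "(\<Sum>x\<in>verts G. descent_energy G f x) = 0"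
    by (simp add: sum_descent_energy harmonic)
  then have "descent_energy G f x = 0" if "x \<in> verts G" for x
    using that by (simp add: sum_nonneg_eq_0_iff descent_energy_nonneg)
  then have le: "f x \<le> f y" if "x \<rightarrow>\<^bsub>G\<^esub> y" for x y
    using square_drop_le_descent_energy[OF that, of f] adj_in_verts(1)[OF that] by simp
  have "f x = f y" if "x \<rightarrow>\<^sup>*\<^bsub>G\<^esub> y"
    using that
  proof (induction rule: reachable_induct)
    case (step y z)
    then show ?case using le[of y z] le[of z y] adj_sym[of y z] by simp
  qed simp
  then show ?thesis using assms connected_imp_reachable by blast
qed

text \<open>
  The Laplacian itself is singular, its kernel being the constants and its range the functions of sum zero.
  Adding the all-ones matrix makes it invertible and changes nothing for right-hand sides of sum zero: summing
  the equations shows that the solution has sum zero, so the added term vanishes.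
\<close>

lemma potential_exists:
  assumes "connected G" "u \<in> verts G" "v \<in> verts G"
  obtains \<phi> where "is_potential G u v \<phi>"
proof -
  define K :: "'a \<Rightarrow> 'a \<Rightarrow> real" where
    "K x y = of_bool (x = y) * real (card {z. x \<rightarrow>\<^bsub>G\<^esub> z}) - of_bool (x \<rightarrow>\<^bsub>G\<^esub> y) + 1" for x y
  have K: "(\<Sum>y\<in>verts G. K x y * f y) = laplacian G f x + sum f (verts G)"
    if "x \<in> verts G" for f x
  proof -
    have nb: "{y \<in> verts G. x \<rightarrow>\<^bsub>G\<^esub> y} = {y. x \<rightarrow>\<^bsub>G\<^esub> y}"
      by (auto dest: adj_in_verts)
    have "(\<Sum>y\<in>verts G. of_bool (x \<rightarrow>\<^bsub>G\<^esub> y) * f y) = (\<Sum>y | x \<rightarrow>\<^bsub>G\<^esub> y. f y)"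
      unfolding nb[symmetric] sum.inter_filter[OF finite_verts]
      by (intro sum.cong) auto
    moreover have "(\<Sum>y\<in>verts G. of_bool (x = y) * real (card {z. x \<rightarrow>\<^bsub>G\<^esub> z}) * f y)
        = (\<Sum>y\<in>verts G. if y = x then card {z. x \<rightarrow>\<^bsub>G\<^esub> z} * f y else 0)"
      by (intro sum.cong) auto
    then have "(\<Sum>y\<in>verts G. of_bool (x = y) * real (card {z. x \<rightarrow>\<^bsub>G\<^esub> z}) * f y)
        = card {z. x \<rightarrow>\<^bsub>G\<^esub> z} * f x"
      using that by simp
    ultimately show ?thesis
      by (simp add: K_def laplacian_def sum_subtractf sum.distrib algebra_simps)
  qed
  have card_pos: "card (verts G) > 0"
    using assms by (auto simp: card_gt_0_iff)
  \<comment> \<open>Summing the equations kills the Laplacian and isolates the sum of \<open>f\<close>.\<close>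
  have total: "sum f (verts G) = 0 \<and> (\<forall>x\<in>verts G. laplacian G f x = g x)"
    if eq: "\<And>x. x \<in> verts G \<Longrightarrow> (\<Sum>y\<in>verts G. K x y * f y) = g x"
      and g: "sum g (verts G) = 0" for f g
  proof -
    have "(\<Sum>x\<in>verts G. laplacian G f x + sum f (verts G)) = sum g (verts G)"
      by (intro sum.cong) (auto simp: K[symmetric] eq)
    then have 0: "sum f (verts G) = 0"
      using card_pos g by (auto simp: sum.distrib sum_laplacian_eq_0)
    moreover have "laplacian G f x = g x" if "x \<in> verts G" for x
      using eq[OF that] K[OF that, of f] 0 by simp
    ultimately show ?thesis by blast
  qed
  have kernel: "\<forall>x\<in>verts G. f x = 0"
    if "\<And>x. x \<in> verts G \<Longrightarrow> (\<Sum>y\<in>verts G. K x y * f y) = 0" for f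
  proof
    have f: "sum f (verts G) = 0" "\<forall>x\<in>verts G. laplacian G f x = 0"
      using total[of f "\<lambda>_. 0"] that by auto
    fix x assume "x \<in> verts G"
    then have "sum f (verts G) = (\<Sum>y\<in>verts G. f x)"
      using f(2) by (intro sum.cong harmonic_imp_constant[OF \<open>connected G\<close>]) auto
    then show "f x = 0" using f(1) card_pos by auto
  qed
  have "\<exists>\<phi>. \<forall>x\<in>verts G. (\<Sum>y\<in>verts G. K x y * \<phi> y) = of_bool (x = u) - of_bool (x = v)"
    by (rule square_system_solvable[OF finite_verts]) (rule kernel)
  then obtain \<phi> where \<phi>: "\<And>x. x \<in> verts G \<Longrightarrow>
      (\<Sum>y\<in>verts G. K x y * \<phi> y) = of_bool (x = u) - of_bool (x = v)"
    by blast
  have "(\<Sum>x\<in>verts G. of_bool (x = u) - of_bool (x = v)) = (0::real)"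
    using assms by (simp add: sum_subtractf of_bool_def)
  then have "is_potential G u v \<phi>"
    using total[OF \<phi>] by (simp add: is_potential_def)
  then show thesis by (rule that)
qed

lemma resistance_distance_eq:
  assumes "connected G" "u \<in> verts G" "v \<in> verts G" "u \<noteq> v" "is_potential G u v \<phi>"
  shows "resistance_distance G u v = \<phi> u - \<phi> v"
proof -
  have "\<psi> u - \<psi> v = \<phi> u - \<phi> v" if "is_potential G u v \<psi>" for \<psi>
  proof -
    have "\<psi> u - \<phi> u = \<psi> v - \<phi> v"
      using that assms
      by (intro harmonic_imp_constant[of "\<lambda>x. \<psi> x - \<phi> x"])
        (auto simp: laplacian_diff is_potential_def)
    then show ?thesis by simp
  qed
  then have unique: "r = \<phi> u - \<phi> v" if "\<exists>\<psi>. is_potential G u v \<psi> \<and> r = \<psi> u - \<psi> v" for r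
    using that by metis
  have "(THE r. \<exists>\<psi>. is_potential G u v \<psi> \<and> r = \<psi> u - \<psi> v) = \<phi> u - \<phi> v"
  proof (rule the_equality)
    show "\<exists>\<psi>. is_potential G u v \<psi> \<and> \<phi> u - \<phi> v = \<psi> u - \<psi> v"
      using assms(5) by blast
  qed (rule unique)
  then show ?thesis using assms(4) by (simp add: resistance_distance_def)
qed

lemma sum_descent_energy_potential:
  assumes "is_potential G u v \<phi>" "u \<in> verts G" "v \<in> verts G"
  shows "(\<Sum>x\<in>verts G. descent_energy G \<phi> x) = \<phi> u - \<phi> v"
proof -
  have "(\<Sum>x\<in>verts G. \<phi> x * laplacian G \<phi> x)
      = (\<Sum>x\<in>verts G. (if x = u then \<phi> x else 0) - (if x = v then \<phi> x else 0))"
    using assms(1) by (intro sum.cong) (auto simp: is_potential_def)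
  also have "\<dots> = \<phi> u - \<phi> v"
    using assms by (simp add: sum_subtractf)
  finally show ?thesis by (simp add: sum_descent_energy)
qed

section \<open>The bound for pairwise distances at most two\<close>

text \<open>
  The estimate that makes the right-hand side independent of the other end \<open>y\<close>. It linearises
  \<open>t \<le> sqrt (descent_energy G \<phi> x)\<close> with a free parameter \<open>c\<close>, to be taken as the size of the set over which
  \<open>x\<close> is averaged.
\<close>

lemma drop_le_descent_energy:
  assumes "x = y \<or> x \<rightarrow>\<^bsub>G\<^esub> y" "c > 0"
  shows "\<phi> x - \<phi> y \<le> c / 4 * descent_energy G \<phi> x + 1 / c"
  using assms(1)
proof
  assume "x = y"
  then show ?thesis using \<open>c > 0\<close> by (simp add: descent_energy_nonneg)
next
  assume xy: "x \<rightarrow>\<^bsub>G\<^esub> y"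
  define t where "t = max 0 (\<phi> x - \<phi> y)"
  have "t\<^sup>2 \<le> descent_energy G \<phi> x"
    unfolding t_def by (rule square_drop_le_descent_energy[OF xy])
  then have "c / 4 * t\<^sup>2 \<le> c / 4 * descent_energy G \<phi> x"
    using \<open>c > 0\<close> by simp
  moreover have "c / 4 * t\<^sup>2 + 1 / c - t = (c * t - 2)\<^sup>2 / (4 * c)"
    using \<open>c > 0\<close> by (simp add: field_simps power2_eq_square)
  moreover have "(c * t - 2)\<^sup>2 / (4 * c) \<ge> 0"
    using \<open>c > 0\<close> by simp
  moreover have "\<phi> x - \<phi> y \<le> t" by (simp add: t_def)
  ultimately show ?thesis by linarith
qed

lemma mean_neighbours:
  assumes "{y. x \<rightarrow>\<^bsub>G\<^esub> y} \<noteq> {}"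
  shows "(\<Sum>y | x \<rightarrow>\<^bsub>G\<^esub> y. \<phi> y) / card {y. x \<rightarrow>\<^bsub>G\<^esub> y}
    = \<phi> x - laplacian G \<phi> x / card {y. x \<rightarrow>\<^bsub>G\<^esub> y}"
proof -
  have "card {y. x \<rightarrow>\<^bsub>G\<^esub> y} > 0"
    using assms finite_neighbours by (simp add: card_gt_0_iff)
  then show ?thesis
    by (simp add: laplacian_def sum_subtractf field_simps)
qed

text \<open>
  Of the two terms \<open>1 / d\<close> lost here, one is the drop from \<open>u\<close> to an average neighbour and the other the
  constant in the estimate of a single drop. The quarter of \<open>\<phi> u - \<phi> v\<close> is the energy
  term: even over all vertices, the descent energies only add up to \<open>\<phi> u - \<phi> v\<close>.
\<close>

lemma mean_neighbours_minus_energy: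
  assumes "is_potential G u v \<phi>" "u \<in> verts G" "v \<in> verts G" "u \<noteq> v"
    and ne: "{x. u \<rightarrow>\<^bsub>G\<^esub> x} \<noteq> {}"
  defines "d \<equiv> real (card {x. u \<rightarrow>\<^bsub>G\<^esub> x})"
  shows "\<phi> u - 2 / d - (\<phi> u - \<phi> v) / 4
    \<le> (\<Sum>x | u \<rightarrow>\<^bsub>G\<^esub> x. \<phi> x - (d / 4 * descent_energy G \<phi> x + 1 / d)) / d"
proof -
  let ?E = "\<Sum>x | u \<rightarrow>\<^bsub>G\<^esub> x. descent_energy G \<phi> x"
  have d: "d > 0"
    using ne finite_neighbours by (simp add: d_def card_gt_0_iff)
  have "?E \<le> (\<Sum>x\<in>verts G. descent_energy G \<phi> x)"
    by (intro sum_mono2) (auto simp: descent_energy_nonneg dest: adj_in_verts)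
  then have E: "?E \<le> \<phi> u - \<phi> v"
    using assms by (simp add: sum_descent_energy_potential)
  have mean: "(\<Sum>x | u \<rightarrow>\<^bsub>G\<^esub> x. \<phi> x) / d = \<phi> u - 1 / d"
    using assms mean_neighbours[OF ne, of \<phi>] by (simp add: is_potential_def)
  have "(\<Sum>x | u \<rightarrow>\<^bsub>G\<^esub> x. \<phi> x - (d / 4 * descent_energy G \<phi> x + 1 / d))
      = (\<Sum>x | u \<rightarrow>\<^bsub>G\<^esub> x. \<phi> x) - d / 4 * ?E - 1"
    using d by (simp add: sum_subtractf sum.distrib sum_distrib_left d_def)
  also have "\<dots> / d = (\<Sum>x | u \<rightarrow>\<^bsub>G\<^esub> x. \<phi> x) / d - ?E / 4 - 1 / d"
    using d by (simp add: diff_divide_distrib)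
  finally show ?thesis using E mean by simp
qed

text \<open>
  The side of \<open>v\<close> is the side of \<open>u\<close> for the reversed current, whose potential is \<open>- \<phi>\<close>. Both sides
  charge a quarter of \<open>r\<close> to the energy, which leaves half of \<open>r\<close> to be bounded.
\<close>

lemma resistance_distance_le:
  assumes conn: "connected G"
    and close: "\<And>x y. x \<in> verts G \<Longrightarrow> y \<in> verts G \<Longrightarrow>
      \<exists>w. (x = w \<or> x \<rightarrow>\<^bsub>G\<^esub> w) \<and> (w = y \<or> w \<rightarrow>\<^bsub>G\<^esub> y)"
    and uv: "u \<in> verts G" "v \<in> verts G" "u \<noteq> v"
  shows "resistance_distance G u v \<le> 4 * (1 / out_degree G u + 1 / out_degree G v)"
proof -
  obtain \<phi> where \<phi>: "is_potential G u v \<phi>"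
    using potential_exists[OF conn uv(1,2)] .
  define r where "r = \<phi> u - \<phi> v"
  have r: "resistance_distance G u v = r"
    using resistance_distance_eq[OF conn uv \<phi>] by (simp add: r_def)
  let ?A = "{x. u \<rightarrow>\<^bsub>G\<^esub> x}" and ?B = "{x. v \<rightarrow>\<^bsub>G\<^esub> x}"
  define m n where "m = real (card ?A)" and "n = real (card ?B)"
  have A: "?A \<noteq> {}" and B: "?B \<noteq> {}"
    using close[OF uv(1,2)] close[OF uv(2,1)] uv(3) by auto
  have pos: "m > 0" "n > 0"
    using A B finite_neighbours by (simp_all add: m_def n_def card_gt_0_iff)
  define f where "f x = \<phi> x - (m / 4 * descent_energy G \<phi> x + 1 / m)" for x
  define g where "g x = - \<phi> x - (n / 4 * descent_energy G (\<lambda>x. - \<phi> x) x + 1 / n)" for x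
  have "f a \<le> - g b" if ab: "a \<in> ?A" "b \<in> ?B" for a b
  proof -
    have "a \<in> verts G" "b \<in> verts G"
      using ab by (auto dest: adj_in_verts)
    then obtain w where w: "a = w \<or> a \<rightarrow>\<^bsub>G\<^esub> w" "w = b \<or> w \<rightarrow>\<^bsub>G\<^esub> b"
      using close by blast
    then have "b = w \<or> b \<rightarrow>\<^bsub>G\<^esub> w" using adj_sym by blast
    from drop_le_descent_energy[OF w(1) pos(1), of \<phi>]
      drop_le_descent_energy[OF this pos(2), of "\<lambda>x. - \<phi> x"]
    show ?thesis by (simp add: f_def g_def)
  qed
  then have "sum f ?A / m \<le> sum (\<lambda>b. - g b) ?B / n"
    unfolding m_def n_def using A B finite_neighbours by (intro mean_le_mean) auto
  moreover have "\<phi> u - 2 / m - r / 4 \<le> sum f ?A / m"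
    using mean_neighbours_minus_energy[OF \<phi> uv A] by (simp add: f_def r_def m_def)
  moreover have "- \<phi> v - 2 / n - r / 4 \<le> sum g ?B / n"
  proof -
    have "is_potential G v u (\<lambda>x. - \<phi> x)"
      using \<phi> by (simp add: is_potential_def laplacian_uminus)
    from mean_neighbours_minus_energy[OF this uv(2,1) uv(3)[symmetric] B]
    show ?thesis by (simp add: g_def r_def n_def)
  qed
  ultimately have "r \<le> 2 * (2 / m + 2 / n)"
    unfolding sum_negf minus_divide_left[symmetric] r_def by argo
  then show ?thesis
    by (simp add: r m_def n_def out_degree_eq_card_neighbours)
qed

lemma diameter_two_imp_common_neighbour:
  assumes diam: "graph_diameter G = 2" and "x \<in> verts G" "y \<in> verts G"
  shows "\<exists>w. (x = w \<or> x \<rightarrow>\<^bsub>G\<^esub> w) \<and> (w = y \<or> w \<rightarrow>\<^bsub>G\<^esub> y)"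
proof -
  have "{graph_dist G a b | a b. a \<in> verts G \<and> b \<in> verts G}
      = (\<lambda>(a, b). graph_dist G a b) ` (verts G \<times> verts G)"
    by auto
  then have "finite {graph_dist G a b | a b. a \<in> verts G \<and> b \<in> verts G}"
    by simp
  then have "graph_dist G x y \<le> graph_diameter G"
    unfolding graph_diameter_def using assms by (intro Max_ge) auto
  also have "\<dots> < 3" by (simp add: diam)
  finally have "\<mu> (\<lambda>_. 1) x y < 3" by (simp add: graph_dist_def)
  then obtain p where p: "awalk x p y" "ereal (awalk_cost (\<lambda>_. 1) p) < 3"
    by (auto simp: \<mu>_def INF_less_iff)
  \<comment> \<open>With unit weights the cost of a walk is its length, so a cost below 3 leaves at most two arcs.\<close>
  then have "length p < 3"
    by (simp add: awalk_cost_def sum_list_triv)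
  then consider "p = []" | e where "p = [e]" | e e' where "p = [e, e']"
    by (cases p rule: remdups_adj.cases) auto
  then show ?thesis
  proof cases
    case 1
    with p show ?thesis by (auto simp: awalk_simps)
  next
    case 2
    with p have "x \<rightarrow>\<^bsub>G\<^esub> y"
      by (auto simp: awalk_simps intro: in_arcs_imp_in_arcs_ends)
    then show ?thesis by blast
  next
    case 3
    with p have "x \<rightarrow>\<^bsub>G\<^esub> head G e" "head G e \<rightarrow>\<^bsub>G\<^esub> y"
      using in_arcs_imp_in_arcs_ends[of e] in_arcs_imp_in_arcs_ends[of e']
      by (auto simp: awalk_simps)
    then show ?thesis by blast
  qed
qed

end

theorem theorem4p1:
  fixes G :: "('a, 'b) pre_digraph"
  assumes "Digraph.graph G"
    and "Digraph_Component.connected G"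
    and "graph_diameter G = 2"
    and "u \<in> verts G" and "v \<in> verts G" and "u \<noteq> v"
  shows "resistance_distance G u v
    \<le> (3 + sqrt 5) * (1 / real (out_degree G u) + 1 / real (out_degree G v))"
proof -
  interpret graph G by fact
  let ?s = "1 / real (out_degree G u) + 1 / real (out_degree G v)"
  have "resistance_distance G u v \<le> 4 * ?s"
    using assms diameter_two_imp_common_neighbour by (intro resistance_distance_le) auto
  also have "\<dots> \<le> (3 + sqrt 5) * ?s"
    by (intro mult_right_mono) auto
  finally show ?thesis .
qed

end
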